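(* Let $R$ be an associative ring with identity. For any left $R$-module $M$, the inclusion $M\hookrightarrow \operatorname{CE}(M)$ of $M$ in its coneat injective envelope is coneat essential.
   Context: Modules are left unital $R$-modules. A submodule $A\subseteq B$ is coneat if $0\to A\hookrightarrow B\to B/A\to 0$ remains exact after applying $S\otimes_R -$ for every simple right $R$-module $S$. A module $M$ is coneat injective if for every coneat submodule $A\subseteq B$ every homomorphism $A\to M$ extends to $B$. Every module $M$ has a coneat injective envelope $\operatorname{CE}(M)$: a coneat injective module containing $M$ (as a coneat submodule) such that every homomorphism from $M$ to a coneat injective module extends to $\operatorname{CE}(M)$, and every endomorphism of $\operatorname{CE}(M)$ restricting to the identity on $M$ is an automorphism; it is unique up to isomorphism. For a submodule $A\subseteq B$, the inclusion $A\hookrightarrow B$ is coneat essential if $A$ is coneat in $B$ and every homomorphism $\varphi:B\to X$ of $R$-modules such that $\varphi|_A$ is injective and $\varphi(A)$ is coneat in $\varphi(B)$ is itself injective. *)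

theory Defs
  imports "HOL-Algebra.Module" "HOL-Algebra.AbelCoset" "HOL-Algebra.Free_Abelian_Groups"
begin

section \<open>Modules over a not necessarily commutative ring\<close>

text \<open>
  The locale \<^locale>\<open>module\<close> of HOL-Algebra requires a commutative ring. Its record type is
  reused here for left and right modules; the ring multiplication and unit fields that the record
  inherits are never looked at. In a right module, \<open>a \<odot>\<^bsub>S\<^esub> s\<close> stands for the product \<open>s a\<close>, so the
  order of the ring factors is reversed in the associativity law. The library's \<^locale>\<open>submodule\<close>
  does not mention commutativity or associativity and serves for both sides.
\<close>

locale left_module = R?: ring R + M?: abelian_group M
  for R :: "('r, 'z) ring_scheme" (structure) and M :: "('r, 'a) module" (structure) +
  assumes smult_closed:
      "\<lbrakk>a \<in> carrier R; x \<in> carrier M\<rbrakk> \<Longrightarrow> a \<odot>\<^bsub>M\<^esub> x \<in> carrier M"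
    and smult_l_distr:
      "\<lbrakk>a \<in> carrier R; b \<in> carrier R; x \<in> carrier M\<rbrakk> \<Longrightarrow>
        (a \<oplus>\<^bsub>R\<^esub> b) \<odot>\<^bsub>M\<^esub> x = a \<odot>\<^bsub>M\<^esub> x \<oplus>\<^bsub>M\<^esub> b \<odot>\<^bsub>M\<^esub> x"
    and smult_r_distr:
      "\<lbrakk>a \<in> carrier R; x \<in> carrier M; y \<in> carrier M\<rbrakk> \<Longrightarrow>
        a \<odot>\<^bsub>M\<^esub> (x \<oplus>\<^bsub>M\<^esub> y) = a \<odot>\<^bsub>M\<^esub> x \<oplus>\<^bsub>M\<^esub> a \<odot>\<^bsub>M\<^esub> y"
    and smult_assoc:
      "\<lbrakk>a \<in> carrier R; b \<in> carrier R; x \<in> carrier M\<rbrakk> \<Longrightarrow>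
        (a \<otimes>\<^bsub>R\<^esub> b) \<odot>\<^bsub>M\<^esub> x = a \<odot>\<^bsub>M\<^esub> (b \<odot>\<^bsub>M\<^esub> x)"
    and smult_one:
      "x \<in> carrier M \<Longrightarrow> \<one>\<^bsub>R\<^esub> \<odot>\<^bsub>M\<^esub> x = x"

locale right_module = R?: ring R + S?: abelian_group S
  for R :: "('r, 'z) ring_scheme" (structure) and S :: "('r, 's) module" (structure) +
  assumes smult_closed:
      "\<lbrakk>a \<in> carrier R; s \<in> carrier S\<rbrakk> \<Longrightarrow> a \<odot>\<^bsub>S\<^esub> s \<in> carrier S"
    and smult_l_distr:
      "\<lbrakk>a \<in> carrier R; b \<in> carrier R; s \<in> carrier S\<rbrakk> \<Longrightarrow>
        (a \<oplus>\<^bsub>R\<^esub> b) \<odot>\<^bsub>S\<^esub> s = a \<odot>\<^bsub>S\<^esub> s \<oplus>\<^bsub>S\<^esub> b \<odot>\<^bsub>S\<^esub> s"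
    and smult_r_distr:
      "\<lbrakk>a \<in> carrier R; s \<in> carrier S; t \<in> carrier S\<rbrakk> \<Longrightarrow>
        a \<odot>\<^bsub>S\<^esub> (s \<oplus>\<^bsub>S\<^esub> t) = a \<odot>\<^bsub>S\<^esub> s \<oplus>\<^bsub>S\<^esub> a \<odot>\<^bsub>S\<^esub> t"
    and smult_assoc:
      "\<lbrakk>a \<in> carrier R; b \<in> carrier R; s \<in> carrier S\<rbrakk> \<Longrightarrow>
        (a \<otimes>\<^bsub>R\<^esub> b) \<odot>\<^bsub>S\<^esub> s = b \<odot>\<^bsub>S\<^esub> (a \<odot>\<^bsub>S\<^esub> s)"
    and smult_one:
      "s \<in> carrier S \<Longrightarrow> \<one>\<^bsub>R\<^esub> \<odot>\<^bsub>S\<^esub> s = s"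

definition mod_hom ::
    "('r, 'z) ring_scheme \<Rightarrow> ('r, 'a) module \<Rightarrow> ('r, 'b) module \<Rightarrow> ('a \<Rightarrow> 'b) set" where
  "mod_hom R M N = {h \<in> hom (add_monoid M) (add_monoid N).
     \<forall>a \<in> carrier R. \<forall>x \<in> carrier M. h (a \<odot>\<^bsub>M\<^esub> x) = a \<odot>\<^bsub>N\<^esub> h x}"

text \<open>\<open>M\<close> is contained in \<open>E\<close> as a submodule: the carrier of \<open>M\<close> is a submodule of \<open>E\<close>, and the
  module structure of \<open>M\<close> is the one inherited from \<open>E\<close>.\<close>
definition contained_module ::
    "('r, 'z) ring_scheme \<Rightarrow> ('r, 'a) module \<Rightarrow> ('r, 'a) module \<Rightarrow> bool" where
  "contained_module R M E \<longleftrightarrow>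
     submodule (carrier M) R E \<and>
     \<zero>\<^bsub>M\<^esub> = \<zero>\<^bsub>E\<^esub> \<and>
     (\<forall>x \<in> carrier M. \<forall>y \<in> carrier M. x \<oplus>\<^bsub>M\<^esub> y = x \<oplus>\<^bsub>E\<^esub> y) \<and>
     (\<forall>a \<in> carrier R. \<forall>x \<in> carrier M. a \<odot>\<^bsub>M\<^esub> x = a \<odot>\<^bsub>E\<^esub> x)"

definition quotient_module ::
    "('r, 'z) ring_scheme \<Rightarrow> ('r, 'a) module \<Rightarrow> 'a set \<Rightarrow> ('r, 'a set) module" where
  "quotient_module R B A =
     \<lparr>carrier = a_rcosets\<^bsub>B\<^esub> A, monoid.mult = undefined, one = undefined,
      ring.zero = A, ring.add = set_add B,
      smult = (\<lambda>a X. \<Union>x\<in>X. A +>\<^bsub>B\<^esub> (a \<odot>\<^bsub>B\<^esub> x))\<rparr>"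

definition simple_right_module ::
    "('r, 'z) ring_scheme \<Rightarrow> ('r, 's) module \<Rightarrow> bool" where
  "simple_right_module R S \<longleftrightarrow>
     right_module R S \<and> carrier S \<noteq> {\<zero>\<^bsub>S\<^esub>} \<and>
     (\<forall>N. submodule N R S \<longrightarrow> N = {\<zero>\<^bsub>S\<^esub>} \<or> N = carrier S)"

section \<open>Tensor products\<close>

text \<open>The tensor product of a right module \<open>S\<close> and a left module \<open>M\<close>: the free abelian group on
  pairs modulo the subgroup generated by the biadditivity and balancing relators.\<close>

definition tensor_relators ::
    "('r, 'z) ring_scheme \<Rightarrow> ('r, 's) module \<Rightarrow> ('r, 'a) module \<Rightarrow> (('s \<times> 'a) \<Rightarrow>\<^sub>0 int) set" where
  "tensor_relators R S M =
     {frag_of (s \<oplus>\<^bsub>S\<^esub> t, x) - frag_of (s, x) - frag_of (t, x) | s t x.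
        s \<in> carrier S \<and> t \<in> carrier S \<and> x \<in> carrier M} \<union>
     {frag_of (s, x \<oplus>\<^bsub>M\<^esub> y) - frag_of (s, x) - frag_of (s, y) | s x y.
        s \<in> carrier S \<and> x \<in> carrier M \<and> y \<in> carrier M} \<union>
     {frag_of (a \<odot>\<^bsub>S\<^esub> s, x) - frag_of (s, a \<odot>\<^bsub>M\<^esub> x) | a s x.
        a \<in> carrier R \<and> s \<in> carrier S \<and> x \<in> carrier M}"

definition tensor_kernel ::
    "('r, 'z) ring_scheme \<Rightarrow> ('r, 's) module \<Rightarrow> ('r, 'a) module \<Rightarrow> (('s \<times> 'a) \<Rightarrow>\<^sub>0 int) set" where
  "tensor_kernel R S M =
     generate (free_Abelian_group (carrier S \<times> carrier M)) (tensor_relators R S M)"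

definition tensor ::
    "('r, 'z) ring_scheme \<Rightarrow> ('r, 's) module \<Rightarrow> ('r, 'a) module \<Rightarrow> (('s \<times> 'a) \<Rightarrow>\<^sub>0 int) set monoid" where
  "tensor R S M = free_Abelian_group (carrier S \<times> carrier M) Mod tensor_kernel R S M"

text \<open>The map induced by \<open>f : M \<rightarrow> N\<close> on tensor products with \<open>S\<close>. For a module homomorphism \<open>f\<close>
  all members of the union are the same coset.\<close>
definition tensor_map ::
    "('r, 'z) ring_scheme \<Rightarrow> ('r, 's) module \<Rightarrow> ('r, 'a) module \<Rightarrow> ('r, 'b) module \<Rightarrow> ('a \<Rightarrow> 'b) \<Rightarrow>
     (('s \<times> 'a) \<Rightarrow>\<^sub>0 int) set \<Rightarrow> (('s \<times> 'b) \<Rightarrow>\<^sub>0 int) set" where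
  "tensor_map R S M N f X =
     (\<Union>c\<in>X. tensor_kernel R S N #>\<^bsub>free_Abelian_group (carrier S \<times> carrier N)\<^esub>
        frag_extend (\<lambda>(s, x). frag_of (s, f x)) c)"

text \<open>The library's exact sequences require all groups to live on one type.\<close>
definition short_exact ::
    "('a, 'k) monoid_scheme \<Rightarrow> ('b, 'l) monoid_scheme \<Rightarrow> ('c, 'm) monoid_scheme \<Rightarrow>
     ('a \<Rightarrow> 'b) \<Rightarrow> ('b \<Rightarrow> 'c) \<Rightarrow> bool" where
  "short_exact G H K f g \<longleftrightarrow>
     f \<in> hom G H \<and> g \<in> hom H K \<and>
     inj_on f (carrier G) \<and> f ` carrier G = kernel H K g \<and> g ` carrier H = carrier K"

section \<open>Coneat submodules, coneat injectivity, envelopes, coneat essential inclusions\<close>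

text \<open>The simple modules \<open>S\<close> range over those with carrier in \<^typ>\<open>'r set\<close>, the type of the
  quotients of \<open>R\<close>. By \<open>simple_right_module_copy\<close> below every simple right module, on any type, is
  isomorphic to one of these.\<close>
definition coneat ::
    "('r, 'z) ring_scheme \<Rightarrow> 'a set \<Rightarrow> ('r, 'a) module \<Rightarrow> bool" where
  "coneat R A B \<longleftrightarrow>
     submodule A R B \<and>
     (\<forall>S :: ('r, 'r set) module. simple_right_module R S \<longrightarrow>
        short_exact
          (tensor R S (B\<lparr>carrier := A\<rparr>)) (tensor R S B) (tensor R S (quotient_module R B A))
          (tensor_map R S (B\<lparr>carrier := A\<rparr>) B (\<lambda>x. x))
          (tensor_map R S B (quotient_module R B A) (\<lambda>x. A +>\<^bsub>B\<^esub> x)))"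

text \<open>
  HOL cannot quantify over types inside a definition, so in the next two definitions the modules
  quantified over live on the type \<open>'a\<close> of the given module, which acts as the universe (carriers
  are arbitrary subsets of \<open>'a\<close>). For \<open>coneat_injective_envelope\<close> this only enlarges the class of
  envelopes: if \<open>E\<close> is an envelope of \<open>M\<close> with respect to modules on all types, then \<open>E\<close> is in
  particular coneat injective with respect to \<open>'a\<close>; the extension property holds for every target
  \<open>N\<close> that is coneat injective with respect to \<open>'a\<close>, because \<open>M\<close> is coneat in \<open>E\<close> and \<open>E\<close> lives
  on \<open>'a\<close>; and the remaining clauses involve \<open>M\<close> and \<open>E\<close> only.
\<close>
definition coneat_injective ::
    "('r, 'z) ring_scheme \<Rightarrow> ('r, 'a) module \<Rightarrow> bool" where
  "coneat_injective R M \<longleftrightarrow>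
     left_module R M \<and>
     (\<forall>(B :: ('r, 'a) module) A f.
        left_module R B \<and> coneat R A B \<and> f \<in> mod_hom R (B\<lparr>carrier := A\<rparr>) M \<longrightarrow>
        (\<exists>g \<in> mod_hom R B M. \<forall>x \<in> A. g x = f x))"

definition coneat_injective_envelope ::
    "('r, 'z) ring_scheme \<Rightarrow> ('r, 'a) module \<Rightarrow> ('r, 'a) module \<Rightarrow> bool" where
  "coneat_injective_envelope R M E \<longleftrightarrow>
     coneat_injective R E \<and>
     contained_module R M E \<and> coneat R (carrier M) E \<and>
     (\<forall>(N :: ('r, 'a) module) f.
        coneat_injective R N \<and> f \<in> mod_hom R M N \<longrightarrow>
        (\<exists>g \<in> mod_hom R E N. \<forall>x \<in> carrier M. g x = f x)) \<and>
     (\<forall>h \<in> mod_hom R E E. (\<forall>x \<in> carrier M. h x = x) \<longrightarrow> bij_betw h (carrier E) (carrier E))"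

text \<open>The type argument is the type on which the modules \<open>X\<close> live.\<close>
definition coneat_essential ::
    "'x itself \<Rightarrow> ('r, 'z) ring_scheme \<Rightarrow> 'a set \<Rightarrow> ('r, 'a) module \<Rightarrow> bool" where
  "coneat_essential TX R A B \<longleftrightarrow>
     coneat R A B \<and>
     (\<forall>(X :: ('r, 'x) module) \<phi>.
        left_module R X \<and> \<phi> \<in> mod_hom R B X \<and> inj_on \<phi> A \<and>
        coneat R (\<phi> ` A) (X\<lparr>carrier := \<phi> ` carrier B\<rparr>) \<longrightarrow>
        inj_on \<phi> (carrier B))"

section \<open>Simple right modules up to isomorphism\<close>

lemma simple_right_module_copy:
  fixes R :: "('r, 'z) ring_scheme" and S :: "('r, 's) module"
  assumes "simple_right_module R S"
  shows "\<exists>(T :: ('r, 'r set) module) f. simple_right_module R T \<and>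
           f \<in> mod_hom R S T \<and> bij_betw f (carrier S) (carrier T)"
proof -
  have rm: "right_module R S" and nz: "carrier S \<noteq> {\<zero>\<^bsub>S\<^esub>}"
    and simp: "\<And>N. submodule N R S \<Longrightarrow> N = {\<zero>\<^bsub>S\<^esub>} \<or> N = carrier S"
    using assms unfolding simple_right_module_def by auto
  interpret right_module R S by (rule rm)
  obtain u where u: "u \<in> carrier S" "u \<noteq> \<zero>\<^bsub>S\<^esub>"
    using nz S.zero_closed by blast
  define uR where "uR = (\<lambda>a. a \<odot>\<^bsub>S\<^esub> u) ` carrier R"
  have zs: "\<zero>\<^bsub>R\<^esub> \<odot>\<^bsub>S\<^esub> u = \<zero>\<^bsub>S\<^esub>"
    using smult_l_distr[of "\<zero>\<^bsub>R\<^esub>" "\<zero>\<^bsub>R\<^esub>" u] u smult_closed[of "\<zero>\<^bsub>R\<^esub>" u]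
    by (simp add: S.add.r_cancel_one')
  have mi: "\<ominus>\<^bsub>S\<^esub> (a \<odot>\<^bsub>S\<^esub> u) = (\<ominus>\<^bsub>R\<^esub> a) \<odot>\<^bsub>S\<^esub> u" if a: "a \<in> carrier R" for a
  proof -
    have "(\<ominus>\<^bsub>R\<^esub> a) \<odot>\<^bsub>S\<^esub> u \<oplus>\<^bsub>S\<^esub> a \<odot>\<^bsub>S\<^esub> u = \<zero>\<^bsub>S\<^esub>"
      using smult_l_distr[of "\<ominus>\<^bsub>R\<^esub> a" a u] a u by (simp add: R.l_neg zs)
    then show ?thesis using a u by (simp add: S.minus_equality smult_closed)
  qed
  have "submodule uR R S"
  proof (intro submodule.intro subgroup.intro submodule_axioms.intro)
    show "uR \<subseteq> carrier (add_monoid S)"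
      using u by (auto simp: uR_def smult_closed)
    show "x \<otimes>\<^bsub>add_monoid S\<^esub> y \<in> uR" if "x \<in> uR" "y \<in> uR" for x y
      using that u by (auto simp: uR_def smult_l_distr[symmetric])
    show "\<one>\<^bsub>add_monoid S\<^esub> \<in> uR"
      using zs by (force simp: uR_def)
    show "inv\<^bsub>add_monoid S\<^esub> x \<in> uR" if "x \<in> uR" for x
      using that mi by (auto simp: uR_def a_inv_def)
    show "a \<odot>\<^bsub>S\<^esub> x \<in> uR" if "a \<in> carrier R" "x \<in> uR" for a x
      using that u by (auto simp: uR_def smult_assoc[symmetric])
  qed
  moreover have "u \<in> uR"
    using smult_one u unfolding uR_def by (metis R.one_closed imageI)
  ultimately have uR: "uR = carrier S"
    using simp u by blast
  define f where "f = (\<lambda>s. {a \<in> carrier R. a \<odot>\<^bsub>S\<^esub> u = s})"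
  define g where "g = inv_into (carrier S) f"
  have inj: "inj_on f (carrier S)"
  proof (rule inj_onI)
    fix s t assume st: "s \<in> carrier S" "t \<in> carrier S" "f s = f t"
    then obtain a where "a \<in> carrier R" "s = a \<odot>\<^bsub>S\<^esub> u"
      using uR by (auto simp: uR_def)
    then have "a \<in> f s" by (simp add: f_def)
    then show "s = t" using st by (auto simp: f_def)
  qed
  have gf: "g (f s) = s" if "s \<in> carrier S" for s
    using that inj by (simp add: g_def)
  define T :: "('r, 'r set) module" where
    "T = \<lparr>carrier = f ` carrier S, monoid.mult = undefined, one = undefined, ring.zero = f \<zero>\<^bsub>S\<^esub>,
          ring.add = (\<lambda>x y. f (g x \<oplus>\<^bsub>S\<^esub> g y)), smult = (\<lambda>a x. f (a \<odot>\<^bsub>S\<^esub> g x))\<rparr>"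
  have ag: "abelian_group T"
  proof (rule abelian_groupI)
    show "\<exists>y\<in>carrier T. y \<oplus>\<^bsub>T\<^esub> x = \<zero>\<^bsub>T\<^esub>" if "x \<in> carrier T" for x
      using that by (auto simp: T_def gf S.l_neg intro!: bexI[where x = "\<ominus>\<^bsub>S\<^esub> (g x)"])
  qed (auto simp: T_def gf S.a_ac)
  have rmT: "right_module R T"
  proof (intro right_module.intro right_module_axioms.intro ag)
    show "ring R" by unfold_locales
  qed (auto simp: T_def gf smult_closed smult_l_distr smult_r_distr smult_assoc smult_one)
  have fh: "f \<in> mod_hom R S T"
    by (auto simp: mod_hom_def hom_def T_def gf)
  have bij: "bij_betw f (carrier S) (carrier T)"
    using inj by (simp add: bij_betw_def T_def)
  have "N = {\<zero>\<^bsub>T\<^esub>} \<or> N = carrier T" if N: "submodule N R T" for N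
  proof -
    interpret T: abelian_group T by (rule ag)
    interpret N: submodule N R T by (rule N)
    define N' where "N' = {s \<in> carrier S. f s \<in> N}"
    have mT: "f (\<ominus>\<^bsub>S\<^esub> s) = \<ominus>\<^bsub>T\<^esub> (f s)" if s: "s \<in> carrier S" for s
    proof -
      have "f (\<ominus>\<^bsub>S\<^esub> s) \<oplus>\<^bsub>T\<^esub> f s = \<zero>\<^bsub>T\<^esub>"
        using s by (simp add: T_def gf S.l_neg)
      then show ?thesis
        using s T.minus_equality[of "f (\<ominus>\<^bsub>S\<^esub> s)" "f s"] by (simp add: T_def)
    qed
    have "submodule N' R S"
    proof (intro submodule.intro subgroup.intro submodule_axioms.intro)
      show "x \<otimes>\<^bsub>add_monoid S\<^esub> y \<in> N'" if "x \<in> N'" "y \<in> N'" for x y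
        using that N.m_closed[of "f x" "f y"] by (auto simp: N'_def T_def gf)
      show "\<one>\<^bsub>add_monoid S\<^esub> \<in> N'"
        using N.one_closed by (simp add: N'_def T_def)
      show "inv\<^bsub>add_monoid S\<^esub> x \<in> N'" if "x \<in> N'" for x
        using that mT N.m_inv_closed[of "f x"] by (auto simp: N'_def a_inv_def[symmetric])
      show "a \<odot>\<^bsub>S\<^esub> x \<in> N'" if "a \<in> carrier R" "x \<in> N'" for a x
        using that N.smult_closed[of a "f x"] by (auto simp: N'_def T_def gf smult_closed)
    qed (auto simp: N'_def)
    moreover have "N = f ` N'"
      using N.subset by (auto simp: N'_def T_def)
    ultimately show ?thesis
      using simp[of N'] by (auto simp: T_def)
  qed
  moreover have "carrier T \<noteq> {\<zero>\<^bsub>T\<^esub>}"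
    using u inj by (auto simp: T_def inj_on_def)
  ultimately show ?thesis
    using rmT fh bij unfolding simple_right_module_def by blast
qed

end

theory Submission
  imports Defs
begin

text \<open>
  Given \<open>\<phi> : E \<rightarrow> X\<close> injective on \<open>M\<close> with \<open>\<phi>(M)\<close> coneat in \<open>\<phi>(E)\<close>, the inverse
  \<open>\<phi>(M) \<rightarrow> M \<subseteq> E\<close> extends to some \<open>g : \<phi>(E) \<rightarrow> E\<close> by coneat injectivity of \<open>E\<close>. Then \<open>g \<circ> \<phi>\<close> is the
  identity on \<open>M\<close>, hence an automorphism of the envelope \<open>E\<close>, and \<open>\<phi>\<close> is injective. The
  type of \<open>X\<close> is arbitrary while the injectivity of \<open>E\<close> concerns modules on the type of \<open>E\<close>; as
  \<open>\<phi>(E)\<close> is an image of \<open>E\<close>, it has an isomorphic copy there, and coneatness passes to the copy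
  by functoriality of the tensor product.
\<close>

section \<open>Modules and homomorphisms\<close>

lemma mod_homI:
  assumes "\<And>x. x \<in> carrier M \<Longrightarrow> h x \<in> carrier N"
    and "\<And>x y. \<lbrakk>x \<in> carrier M; y \<in> carrier M\<rbrakk> \<Longrightarrow> h (x \<oplus>\<^bsub>M\<^esub> y) = h x \<oplus>\<^bsub>N\<^esub> h y"
    and "\<And>a x. \<lbrakk>a \<in> carrier R; x \<in> carrier M\<rbrakk> \<Longrightarrow> h (a \<odot>\<^bsub>M\<^esub> x) = a \<odot>\<^bsub>N\<^esub> h x"
  shows "h \<in> mod_hom R M N"
  using assms by (auto simp: mod_hom_def hom_def)

lemma mod_homD:
  assumes "h \<in> mod_hom R M N"
  shows "x \<in> carrier M \<Longrightarrow> h x \<in> carrier N"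
    and "\<lbrakk>x \<in> carrier M; y \<in> carrier M\<rbrakk> \<Longrightarrow> h (x \<oplus>\<^bsub>M\<^esub> y) = h x \<oplus>\<^bsub>N\<^esub> h y"
    and "\<lbrakk>a \<in> carrier R; x \<in> carrier M\<rbrakk> \<Longrightarrow> h (a \<odot>\<^bsub>M\<^esub> x) = a \<odot>\<^bsub>N\<^esub> h x"
  using assms by (auto simp: mod_hom_def hom_def)

lemma mod_hom_comp:
  assumes "f \<in> mod_hom R M N" and "g \<in> mod_hom R N P"
  shows "g \<circ> f \<in> mod_hom R M P"
  using assms by (auto intro!: mod_homI simp: mod_homD)

lemma mod_hom_zero_minus:
  assumes "left_module R M" and "left_module R N" and h: "h \<in> mod_hom R M N"
  shows "h \<zero>\<^bsub>M\<^esub> = \<zero>\<^bsub>N\<^esub>" and "x \<in> carrier M \<Longrightarrow> h (\<ominus>\<^bsub>M\<^esub> x) = \<ominus>\<^bsub>N\<^esub> h x"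
proof -
  interpret M: left_module R M by fact
  interpret N: left_module R N by fact
  interpret abelian_group_hom M N h
    using h by (intro abelian_group_homI M.abelian_group_axioms N.abelian_group_axioms
        group_hom.intro M.a_group N.a_group group_hom_axioms.intro) (auto simp: mod_hom_def)
  show "h \<zero>\<^bsub>M\<^esub> = \<zero>\<^bsub>N\<^esub>" "x \<in> carrier M \<Longrightarrow> h (\<ominus>\<^bsub>M\<^esub> x) = \<ominus>\<^bsub>N\<^esub> h x"
    by simp_all
qed

text \<open>Every element of \<open>N\<close> has the form \<open>h u\<close> with \<open>u\<close>
  in \<open>M\<close>, so an operation in \<open>N\<close> is the image of the same operation in
  \<open>M\<close>, and the inverse cancels \<open>h\<close> there.\<close>

lemma mod_hom_inv_into:
  assumes "left_module R M" and h: "h \<in> mod_hom R M N" and bij: "bij_betw h (carrier M) (carrier N)"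
  shows "inv_into (carrier M) h \<in> mod_hom R N M"
proof -
  interpret M: left_module R M by fact
  let ?g = "inv_into (carrier M) h"
  have img: "\<exists>x\<in>carrier M. y = h x" if "y \<in> carrier N" for y
    using bij that by (auto simp: bij_betw_def)
  have g: "?g (h x) = x" if "x \<in> carrier M" for x
    using bij that by (simp add: bij_betw_def)
  show ?thesis
  proof (rule mod_homI)
    show "?g y \<in> carrier M" if "y \<in> carrier N" for y
      using img[OF that] g by auto
    show "?g (x \<oplus>\<^bsub>N\<^esub> y) = ?g x \<oplus>\<^bsub>M\<^esub> ?g y" if xy: "x \<in> carrier N" "y \<in> carrier N" for x y
    proof -
      obtain u v where "u \<in> carrier M" "x = h u" "v \<in> carrier M" "y = h v"
        using img xy by blast
      then show ?thesis using g by (simp flip: mod_homD(2)[OF h])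
    qed
    show "?g (a \<odot>\<^bsub>N\<^esub> x) = a \<odot>\<^bsub>M\<^esub> ?g x" if ax: "a \<in> carrier R" "x \<in> carrier N" for a x
    proof -
      obtain u where "u \<in> carrier M" "x = h u"
        using img ax by blast
      then show ?thesis using g ax by (simp add: M.smult_closed flip: mod_homD(3)[OF h])
    qed
  qed
qed

section \<open>Submodules and their images\<close>

context left_module
begin

text \<open>An additive wording of the library locale, whose subgroup part is phrased
  multiplicatively for \<open>add_monoid M\<close>.\<close>

lemma submoduleI:
  assumes "H \<subseteq> carrier M" and "\<zero>\<^bsub>M\<^esub> \<in> H"
    and "\<And>x. x \<in> H \<Longrightarrow> \<ominus>\<^bsub>M\<^esub> x \<in> H"
    and "\<And>x y. \<lbrakk>x \<in> H; y \<in> H\<rbrakk> \<Longrightarrow> x \<oplus>\<^bsub>M\<^esub> y \<in> H"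
    and "\<And>a x. \<lbrakk>a \<in> carrier R; x \<in> H\<rbrakk> \<Longrightarrow> a \<odot>\<^bsub>M\<^esub> x \<in> H"
  shows "submodule H R M"
  using assms by (intro submodule.intro subgroup.intro submodule_axioms.intro) (auto simp: a_inv_def)

lemma submoduleD:
  assumes "submodule H R M"
  shows "H \<subseteq> carrier M" and "\<zero>\<^bsub>M\<^esub> \<in> H"
    and "x \<in> H \<Longrightarrow> \<ominus>\<^bsub>M\<^esub> x \<in> H"
    and "\<lbrakk>x \<in> H; y \<in> H\<rbrakk> \<Longrightarrow> x \<oplus>\<^bsub>M\<^esub> y \<in> H"
    and "\<lbrakk>a \<in> carrier R; x \<in> H\<rbrakk> \<Longrightarrow> a \<odot>\<^bsub>M\<^esub> x \<in> H"
proof -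
  interpret H: submodule H R M by fact
  show "H \<subseteq> carrier M" "\<zero>\<^bsub>M\<^esub> \<in> H" "x \<in> H \<Longrightarrow> \<ominus>\<^bsub>M\<^esub> x \<in> H"
    "\<lbrakk>x \<in> H; y \<in> H\<rbrakk> \<Longrightarrow> x \<oplus>\<^bsub>M\<^esub> y \<in> H" "\<lbrakk>a \<in> carrier R; x \<in> H\<rbrakk> \<Longrightarrow> a \<odot>\<^bsub>M\<^esub> x \<in> H"
    using H.subset H.one_closed H.m_inv_closed H.m_closed by (auto simp: a_inv_def)
qed

lemma left_module_submodule:
  assumes "submodule H R M"
  shows "left_module R (M\<lparr>carrier := H\<rparr>)"
proof -
  note H = submoduleD[OF assms] submoduleD(1)[OF assms, THEN subsetD]
  show ?thesis
  proof (intro left_module.intro left_module_axioms.intro R.ring_axioms abelian_groupI)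
    show "\<exists>y\<in>carrier (M\<lparr>carrier := H\<rparr>). y \<oplus>\<^bsub>M\<lparr>carrier := H\<rparr>\<^esub> x = \<zero>\<^bsub>M\<lparr>carrier := H\<rparr>\<^esub>"
      if "x \<in> carrier (M\<lparr>carrier := H\<rparr>)" for x
      using that H by (auto simp: M.l_neg intro!: bexI[where x = "\<ominus>\<^bsub>M\<^esub> x"])
  qed (use H in \<open>auto simp: M.a_ac smult_l_distr smult_r_distr smult_assoc smult_one\<close>)
qed

lemma submodule_image:
  assumes N: "left_module R N" and h: "h \<in> mod_hom R M N" and H: "submodule H R M"
  shows "submodule (h ` H) R N"
proof -
  note HD = submoduleD[OF H] submoduleD(1)[OF H, THEN subsetD]
  note hD = mod_homD[OF h] mod_hom_zero_minus[OF left_module_axioms N h]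
  show ?thesis
  proof (rule left_module.submoduleI[OF N])
    show "\<zero>\<^bsub>N\<^esub> \<in> h ` H"
      using HD(2) hD(4) by (metis imageI)
    show "\<ominus>\<^bsub>N\<^esub> x \<in> h ` H" if "x \<in> h ` H" for x
      using that HD by (auto simp flip: hD(5))
    show "x \<oplus>\<^bsub>N\<^esub> y \<in> h ` H" if "x \<in> h ` H" "y \<in> h ` H" for x y
      using that HD by (auto simp flip: hD(2))
    show "a \<odot>\<^bsub>N\<^esub> x \<in> h ` H" if "a \<in> carrier R" "x \<in> h ` H" for a x
      using that HD by (auto simp flip: hD(3))
  qed (use HD hD in auto)
qed

lemma carrier_submodule: "submodule (carrier M) R M"
  by (rule submoduleI) (auto simp: smult_closed)

section \<open>Cosets and quotient modules\<close>

lemma abelian_subgroup_submodule: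
  assumes "submodule H R M"
  shows "abelian_subgroup H M"
  using assms by (intro abelian_subgroupI3 additive_subgroup.intro M.abelian_group_axioms)
    (simp add: submodule_def)

text \<open>Replacing \<open>x\<close> by \<open>u\<close> plus \<open>x\<close> with
  \<open>u\<close> in \<open>H\<close> changes the scalar multiple by an element of
  \<open>H\<close>. Hence all cosets in the union that defines the scalar multiplication
  coincide.\<close>

lemma quotient_smult:
  assumes H: "submodule H R M" and a: "a \<in> carrier R" and x: "x \<in> carrier M"
  shows "a \<odot>\<^bsub>quotient_module R M H\<^esub> (H +>\<^bsub>M\<^esub> x) = H +>\<^bsub>M\<^esub> (a \<odot>\<^bsub>M\<^esub> x)"
proof -
  interpret H: abelian_subgroup H M
    using H by (rule abelian_subgroup_submodule)
  have "H +>\<^bsub>M\<^esub> (a \<odot>\<^bsub>M\<^esub> y) = H +>\<^bsub>M\<^esub> (a \<odot>\<^bsub>M\<^esub> x)" if y: "y \<in> H +>\<^bsub>M\<^esub> x" for y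
  proof -
    obtain u where u: "u \<in> H" "y = u \<oplus>\<^bsub>M\<^esub> x"
      using y by (auto simp: a_r_coset_def')
    have "a \<odot>\<^bsub>M\<^esub> y = a \<odot>\<^bsub>M\<^esub> u \<oplus>\<^bsub>M\<^esub> a \<odot>\<^bsub>M\<^esub> x"
      using u a x H.a_subset by (auto simp: smult_r_distr)
    moreover have "a \<odot>\<^bsub>M\<^esub> u \<in> H"
      using submoduleD(5)[OF H] a u by blast
    ultimately have "a \<odot>\<^bsub>M\<^esub> y \<in> H +>\<^bsub>M\<^esub> (a \<odot>\<^bsub>M\<^esub> x)"
      by (auto simp: a_r_coset_def')
    then show ?thesis
      using a x smult_closed H.a_repr_independence' by metis
  qed
  then have "(\<Union>y\<in>H +>\<^bsub>M\<^esub> x. H +>\<^bsub>M\<^esub> (a \<odot>\<^bsub>M\<^esub> y)) = H +>\<^bsub>M\<^esub> (a \<odot>\<^bsub>M\<^esub> x)"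
    by (intro UN_constant_eq[OF H.a_rcos_self[OF x]] ballI)
  then show ?thesis
    by (simp only: quotient_module_def module.simps)
qed

lemma quotient_add:
  assumes H: "submodule H R M" and "x \<in> carrier M" "y \<in> carrier M"
  shows "(H +>\<^bsub>M\<^esub> x) \<oplus>\<^bsub>quotient_module R M H\<^esub> (H +>\<^bsub>M\<^esub> y) = H +>\<^bsub>M\<^esub> (x \<oplus>\<^bsub>M\<^esub> y)"
  using abelian_subgroup.a_rcos_sum[OF abelian_subgroup_submodule[OF H]] assms
  by (simp add: quotient_module_def)

lemma quotient_zero:
  assumes "submodule H R M"
  shows "\<zero>\<^bsub>quotient_module R M H\<^esub> = H +>\<^bsub>M\<^esub> \<zero>\<^bsub>M\<^esub>"
  using submoduleD(1)[OF assms] by (simp add: quotient_module_def)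

lemma carrier_quotient_module:
  "carrier (quotient_module R M H) = (\<lambda>x. H +>\<^bsub>M\<^esub> x) ` carrier M"
  by (auto simp: quotient_module_def A_RCOSETS_def')

lemma left_module_quotient:
  assumes H: "submodule H R M"
  shows "left_module R (quotient_module R M H)"
proof (intro left_module.intro left_module_axioms.intro R.ring_axioms abelian_groupI)
  note q = carrier_quotient_module quotient_add[OF H] quotient_smult[OF H] quotient_zero[OF H]
  show "\<exists>y\<in>carrier (quotient_module R M H). y \<oplus>\<^bsub>quotient_module R M H\<^esub> x = \<zero>\<^bsub>quotient_module R M H\<^esub>"
    if x: "x \<in> carrier (quotient_module R M H)" for x
  proof -
    obtain u where "u \<in> carrier M" "x = H +>\<^bsub>M\<^esub> u"
      using x by (auto simp: q)
    then show ?thesis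
      by (intro bexI[where x = "H +>\<^bsub>M\<^esub> (\<ominus>\<^bsub>M\<^esub> u)"]) (auto simp: q M.l_neg)
  qed
  show "\<zero>\<^bsub>quotient_module R M H\<^esub> \<in> carrier (quotient_module R M H)"
    unfolding q by blast
  show "\<zero>\<^bsub>quotient_module R M H\<^esub> \<oplus>\<^bsub>quotient_module R M H\<^esub> x = x"
    if "x \<in> carrier (quotient_module R M H)" for x
    \<comment> \<open>The simplification rule \<open>M.a_coset_add_zero\<close> would collapse the
      zero coset to \<open>H\<close> and keep \<open>quotient_add\<close> from matching.\<close>
    using that unfolding q(1) q(4) by (auto simp del: M.a_coset_add_zero simp: q(2))
qed (auto simp: carrier_quotient_module quotient_add[OF H] quotient_smult[OF H] M.a_ac smult_closed
  smult_l_distr smult_r_distr smult_assoc smult_one)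

lemma mod_hom_quotient:
  assumes "submodule H R M"
  shows "(\<lambda>x. H +>\<^bsub>M\<^esub> x) \<in> mod_hom R M (quotient_module R M H)"
  by (rule mod_homI) (simp_all add: carrier_quotient_module quotient_add quotient_smult assms)

text \<open>Because of this, taking direct images under \<open>h\<close> serves as the map induced
  on quotients.\<close>

lemma image_a_r_coset:
  assumes h: "h \<in> mod_hom R M N" and "H \<subseteq> carrier M" "x \<in> carrier M"
  shows "h ` (H +>\<^bsub>M\<^esub> x) = h ` H +>\<^bsub>N\<^esub> h x"
proof -
  have "h (u \<oplus>\<^bsub>M\<^esub> x) = h u \<oplus>\<^bsub>N\<^esub> h x" if "u \<in> H" for u
    using assms that by (intro mod_homD(2)[OF h]) auto
  then show ?thesis
    by (force simp: a_r_coset_def')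
qed

text \<open>Transport of structure along an injection of sets, possibly into another type. In this
  way the image of \<phi>, which lives on \<open>'x\<close>, is replaced by a module on the type of
  \<open>E\<close>.\<close>

lemma left_module_copy:
  fixes r :: "'a \<Rightarrow> 'c"
  assumes inj: "inj_on r (carrier M)"
  obtains N where "left_module R N" "carrier N = r ` carrier M" "r \<in> mod_hom R M N"
proof -
  define g where "g = inv_into (carrier M) r"
  have gr: "g (r x) = x" if "x \<in> carrier M" for x
    using that inj by (simp add: g_def)
  define N :: "('r, 'c) module" where
    "N = \<lparr>carrier = r ` carrier M, monoid.mult = undefined, one = undefined, ring.zero = r \<zero>\<^bsub>M\<^esub>,
          ring.add = (\<lambda>x y. r (g x \<oplus>\<^bsub>M\<^esub> g y)), smult = (\<lambda>a x. r (a \<odot>\<^bsub>M\<^esub> g x))\<rparr>"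
  have "left_module R N"
  proof (intro left_module.intro left_module_axioms.intro R.ring_axioms abelian_groupI)
    show "\<exists>y\<in>carrier N. y \<oplus>\<^bsub>N\<^esub> x = \<zero>\<^bsub>N\<^esub>" if "x \<in> carrier N" for x
      using that by (auto simp: N_def gr M.l_neg intro!: bexI[where x = "\<ominus>\<^bsub>M\<^esub> (g x)"])
  qed (auto simp: N_def gr M.a_ac smult_closed smult_l_distr smult_r_distr smult_assoc smult_one)
  moreover have "r \<in> mod_hom R M N"
    by (rule mod_homI) (auto simp: N_def gr)
  ultimately show thesis
    using that by (simp add: N_def)
qed

end

section \<open>Functoriality of the tensor product\<close>

text \<open>To conclude that \<open>generate\<close> yields a subgroup, the generators must lie in
  the carrier; the relators do, since both modules are closed under their operations.\<close>

lemma subgroup_tensor_kernel: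
  assumes "right_module R S" and "left_module R M"
  shows "subgroup (tensor_kernel R S M) (free_Abelian_group (carrier S \<times> carrier M))"
proof -
  interpret S: right_module R S by fact
  interpret M: left_module R M by fact
  have "tensor_relators R S M \<subseteq> carrier (free_Abelian_group (carrier S \<times> carrier M))"
    unfolding tensor_relators_def
    by (auto simp: S.smult_closed M.smult_closed dest!: keys_diff[THEN subsetD])
  then show ?thesis
    unfolding tensor_kernel_def by (simp add: group.generate_is_subgroup)
qed

lemma normal_tensor_kernel:
  assumes "right_module R S" and "left_module R M"
  shows "tensor_kernel R S M \<lhd> free_Abelian_group (carrier S \<times> carrier M)"
  using subgroup_tensor_kernel[OF assms]
  by (simp add: comm_group.subgroup_imp_normal abelian_free_Abelian_group)

lemma group_tensor:
  assumes "right_module R S" and "left_module R M"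
  shows "group (tensor R S M)"
  using normal.factorgroup_is_group[OF normal_tensor_kernel[OF assms]] by (simp add: tensor_def)

lemma carrier_tensor:
  "carrier (tensor R S M) =
     (\<lambda>c. tensor_kernel R S M #>\<^bsub>free_Abelian_group (carrier S \<times> carrier M)\<^esub> c) `
       {c. Poly_Mapping.keys c \<subseteq> carrier S \<times> carrier M}"
  by (auto simp: tensor_def FactGroup_def RCOSETS_def)

lemma tensor_carrierE:
  assumes "X \<in> carrier (tensor R S M)"
  obtains c where "Poly_Mapping.keys c \<subseteq> carrier S \<times> carrier M"
    and "X = tensor_kernel R S M #>\<^bsub>free_Abelian_group (carrier S \<times> carrier M)\<^esub> c"
  using assms by (auto simp: carrier_tensor)

section \<open>Maps induced on tensor products\<close>

lemma keys_frag_extend_tensor: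
  assumes "f \<in> mod_hom R M N" and "Poly_Mapping.keys c \<subseteq> carrier S \<times> carrier M"
  shows "Poly_Mapping.keys (frag_extend (\<lambda>(s, x). frag_of (s, f x)) c) \<subseteq> carrier S \<times> carrier N"
  using assms(2) by (intro order_trans[OF keys_frag_extend]) (auto simp: mod_homD(1)[OF assms(1)])

text \<open>By linearity of \<open>f\<close> each relator goes to a relator of the same kind, and an
  additive map sends the subgroup generated by the relators into the subgroup generated by their
  images. This is what makes the induced map well defined.\<close>

lemma frag_extend_tensor_kernel:
  assumes S: "right_module R S" and M: "left_module R M" and f: "f \<in> mod_hom R M N"
    and k: "k \<in> tensor_kernel R S M"
  shows "frag_extend (\<lambda>(s, x). frag_of (s, f x)) k \<in> tensor_kernel R S N"
proof -
  interpret M: left_module R M by fact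
  interpret S: right_module R S by fact
  let ?F = "frag_extend (\<lambda>(s, x). frag_of (s, f x))"
  have rel: "?F k \<in> tensor_relators R S N" if "k \<in> tensor_relators R S M" for k
    using that unfolding tensor_relators_def
  proof (elim UnE CollectE exE conjE, goal_cases)
    case (1 s t x)
    then have "?F k = frag_of (s \<oplus>\<^bsub>S\<^esub> t, f x) - frag_of (s, f x) - frag_of (t, f x)"
      by (simp add: frag_extend_diff)
    then show ?case
      using 1 mod_homD(1)[OF f] by (intro UnI1) blast
  next
    case (2 s x y)
    then have "?F k = frag_of (s, f x \<oplus>\<^bsub>N\<^esub> f y) - frag_of (s, f x) - frag_of (s, f y)"
      by (simp add: frag_extend_diff mod_homD(2)[OF f])
    then show ?case
      using 2 mod_homD(1)[OF f] by (intro UnI1[OF UnI2]) blast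
  next
    case (3 a s x)
    then have "?F k = frag_of (a \<odot>\<^bsub>S\<^esub> s, f x) - frag_of (s, a \<odot>\<^bsub>N\<^esub> f x)"
      by (simp add: frag_extend_diff mod_homD(3)[OF f])
    then show ?case
      using 3 mod_homD(1)[OF f] by (intro UnI2) blast
  qed
  have keys: "Poly_Mapping.keys k \<subseteq> carrier S \<times> carrier M" if "k \<in> tensor_relators R S M" for k
    using that unfolding tensor_relators_def
    by (auto simp: S.smult_closed M.smult_closed dest!: keys_diff[THEN subsetD])
  show ?thesis
    using k unfolding tensor_kernel_def
  proof induction
    case one
    then show ?case
      using generate.one[of "free_Abelian_group (carrier S \<times> carrier N)"] by simp
  next
    case (incl h)
    then show ?case
      using rel by (blast intro: generate.incl)
  next
    case (inv h)
    then show ?case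
      \<comment> \<open>Inversion in the free abelian group simplifies to negation on elements of
        its carrier, hence the bounds on the keys.\<close>
      using generate.inv[OF rel[OF inv], of "free_Abelian_group (carrier S \<times> carrier N)"]
        keys[OF inv] keys_frag_extend_tensor[OF f keys[OF inv]]
      by (simp add: frag_extend_minus)
  next
    case (eng h1 h2)
    then show ?case
      using generate.eng[OF eng(3,4)] by (simp add: frag_extend_add)
  qed
qed

text \<open>Two representatives of a class differ by an element of the kernel, whose image lies in
  the target kernel, so all members of the union in \<open>tensor_map\<close> agree. The facts about
  induced maps below rest on this computation rule.\<close>

lemma tensor_map_coset:
  assumes S: "right_module R S" and M: "left_module R M" and N: "left_module R N"
    and f: "f \<in> mod_hom R M N" and c: "Poly_Mapping.keys c \<subseteq> carrier S \<times> carrier M"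
  shows "tensor_map R S M N f (tensor_kernel R S M #>\<^bsub>free_Abelian_group (carrier S \<times> carrier M)\<^esub> c)
    = tensor_kernel R S N #>\<^bsub>free_Abelian_group (carrier S \<times> carrier N)\<^esub>
        frag_extend (\<lambda>(s, x). frag_of (s, f x)) c"
proof -
  let ?F = "frag_extend (\<lambda>(s, x). frag_of (s, f x))"
  let ?G = "free_Abelian_group (carrier S \<times> carrier M)" and ?K = "tensor_kernel R S M"
  let ?H = "free_Abelian_group (carrier S \<times> carrier N)" and ?L = "tensor_kernel R S N"
  note sub = subgroup_tensor_kernel[OF S M] subgroup_tensor_kernel[OF S N]
  have "?L #>\<^bsub>?H\<^esub> ?F d = ?L #>\<^bsub>?H\<^esub> ?F c" if d: "d \<in> ?K #>\<^bsub>?G\<^esub> c" for d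
  proof -
    obtain k where k: "k \<in> ?K" "d = k + c"
      using d by (auto simp: r_coset_def)
    then have "?F d \<in> ?L #>\<^bsub>?H\<^esub> ?F c"
      using frag_extend_tensor_kernel[OF S M f k(1)] by (auto simp: r_coset_def frag_extend_add)
    then show ?thesis
      using group.repr_independence[OF group_free_Abelian_group _ _ sub(2)]
        keys_frag_extend_tensor[OF f c] by (metis carrier_free_Abelian_group_iff)
  qed
  \<comment> \<open>The union is thus nonempty, and its common value can be read off at
    \<open>c\<close>.\<close>
  moreover have "c \<in> ?K #>\<^bsub>?G\<^esub> c"
    using c by (intro group.rcos_self sub) simp_all
  ultimately show ?thesis
    unfolding tensor_map_def by blast
qed

text \<open>Cosets are added through representatives, and \<open>frag_extend\<close> is additive on
  these.\<close>

lemma tensor_map_hom: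
  fixes S :: "('r, 's) module" and M :: "('r, 'a) module"
  assumes S: "right_module R S" and M: "left_module R M" and N: "left_module R N"
    and f: "f \<in> mod_hom R M N"
  shows "tensor_map R S M N f \<in> hom (tensor R S M) (tensor R S N)"
proof -
  note T = tensor_map_coset[OF S M N f] keys_frag_extend_tensor[OF f]
  note sum = normal.rcos_sum[OF normal_tensor_kernel[OF S M]] normal.rcos_sum[OF normal_tensor_kernel[OF S N]]
  have add: "Poly_Mapping.keys (c + d) \<subseteq> carrier S \<times> carrier M"
    if "Poly_Mapping.keys c \<subseteq> carrier S \<times> carrier M" "Poly_Mapping.keys d \<subseteq> carrier S \<times> carrier M"
    for c d :: "'s \<times> 'a \<Rightarrow>\<^sub>0 int"
    using that keys_add[of c d] by blast
  show ?thesis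
  proof (rule homI)
    show "tensor_map R S M N f x \<in> carrier (tensor R S N)" if "x \<in> carrier (tensor R S M)" for x
      using that
    proof (rule tensor_carrierE)
      fix c assume "Poly_Mapping.keys c \<subseteq> carrier S \<times> carrier M"
        and "x = tensor_kernel R S M #>\<^bsub>free_Abelian_group (carrier S \<times> carrier M)\<^esub> c"
      then show ?thesis
        unfolding carrier_tensor by (simp only: T imageI mem_Collect_eq)
    qed
    show "tensor_map R S M N f (x \<otimes>\<^bsub>tensor R S M\<^esub> y)
        = tensor_map R S M N f x \<otimes>\<^bsub>tensor R S N\<^esub> tensor_map R S M N f y"
      if "x \<in> carrier (tensor R S M)" "y \<in> carrier (tensor R S M)" for x y
    proof -
      obtain c where "Poly_Mapping.keys c \<subseteq> carrier S \<times> carrier M"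
        and "x = tensor_kernel R S M #>\<^bsub>free_Abelian_group (carrier S \<times> carrier M)\<^esub> c"
        using \<open>x \<in> _\<close> by (rule tensor_carrierE)
      moreover obtain d where "Poly_Mapping.keys d \<subseteq> carrier S \<times> carrier M"
        and "y = tensor_kernel R S M #>\<^bsub>free_Abelian_group (carrier S \<times> carrier M)\<^esub> d"
        using \<open>y \<in> _\<close> by (rule tensor_carrierE)
      ultimately show ?thesis
        using add by (simp add: T tensor_def sum frag_extend_add)
    qed
  qed
qed

lemma tensor_map_comp:
  fixes S :: "('r, 's) module" and M :: "('r, 'a) module"
  assumes S: "right_module R S"
    and M: "left_module R M" and N: "left_module R N" and P: "left_module R P"
    and f: "f \<in> mod_hom R M N" and g: "g \<in> mod_hom R N P" and X: "X \<in> carrier (tensor R S M)"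
  shows "tensor_map R S N P g (tensor_map R S M N f X) = tensor_map R S M P (g \<circ> f) X"
proof -
  \<comment> \<open>Functoriality holds already at the level of formal sums, before passing to
    cosets.\<close>
  have "frag_extend (\<lambda>(s, x). frag_of (s, g x)) (frag_extend (\<lambda>(s, x). frag_of (s, f x)) c)
      = frag_extend (\<lambda>(s, x). frag_of (s, (g \<circ> f) x)) c" for c :: "'s \<times> 'a \<Rightarrow>\<^sub>0 int"
    using frag_extend_compose[of "\<lambda>(s, x). frag_of (s, g x)" "\<lambda>(s, x). (s, f x)" c]
    by (simp add: comp_def case_prod_unfold)
  moreover obtain c where "Poly_Mapping.keys c \<subseteq> carrier S \<times> carrier M"
    and "X = tensor_kernel R S M #>\<^bsub>free_Abelian_group (carrier S \<times> carrier M)\<^esub> c"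
    using X by (rule tensor_carrierE)
  ultimately show ?thesis
    by (simp only: tensor_map_coset[OF S M N f] tensor_map_coset[OF S N P g]
        tensor_map_coset[OF S M P mod_hom_comp[OF f g]] keys_frag_extend_tensor[OF f])
qed

text \<open>Representatives are supported on pairs from the carriers, so only the values on
  \<open>carrier M\<close> matter. This is needed because composites with an inverse agree with the
  identity on a carrier but not as HOL functions.\<close>

lemma tensor_map_cong:
  assumes S: "right_module R S" and M: "left_module R M" and N: "left_module R N"
    and f: "f \<in> mod_hom R M N" and g: "g \<in> mod_hom R M N"
    and eq: "\<And>x. x \<in> carrier M \<Longrightarrow> f x = g x" and X: "X \<in> carrier (tensor R S M)"
  shows "tensor_map R S M N f X = tensor_map R S M N g X"
proof -
  obtain c where c: "Poly_Mapping.keys c \<subseteq> carrier S \<times> carrier M"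
    and X: "X = tensor_kernel R S M #>\<^bsub>free_Abelian_group (carrier S \<times> carrier M)\<^esub> c"
    using X by (rule tensor_carrierE)
  have "frag_extend (\<lambda>(s, x). frag_of (s, f x)) c = frag_extend (\<lambda>(s, x). frag_of (s, g x)) c"
    using c eq by (intro frag_extend_eq) auto
  then show ?thesis
    by (simp add: X tensor_map_coset[OF S M N _ c] f g)
qed

text \<open>The additive extension of \<open>frag_of\<close> is the identity on formal sums, by
  \<open>frag_expansion\<close>.\<close>

lemma tensor_map_id:
  assumes S: "right_module R S" and M: "left_module R M" and X: "X \<in> carrier (tensor R S M)"
  shows "tensor_map R S M M (\<lambda>x. x) X = X"
proof -
  have "(\<lambda>x. x) \<in> mod_hom R M M"
    by (rule mod_homI) simp_all
  then show ?thesis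
    using X by (auto simp: carrier_tensor tensor_map_coset S M case_prod_unfold simp flip: frag_expansion)
qed

text \<open>By functoriality, the maps induced by \<open>f\<close> and by its inverse are mutually
  inverse.\<close>

lemma tensor_map_iso:
  assumes S: "right_module R S" and M: "left_module R M" and N: "left_module R N"
    and f: "f \<in> mod_hom R M N" and bij: "bij_betw f (carrier M) (carrier N)"
  shows "tensor_map R S M N f \<in> iso (tensor R S M) (tensor R S N)"
proof -
  let ?g = "inv_into (carrier M) f"
  have g: "?g \<in> mod_hom R N M"
    using M f bij by (rule mod_hom_inv_into)
  have id: "(\<lambda>x. x) \<in> mod_hom R M M" "(\<lambda>x. x) \<in> mod_hom R N N"
    by (auto intro: mod_homI)
  have "tensor_map R S N M ?g (tensor_map R S M N f X) = X" if X: "X \<in> carrier (tensor R S M)" for X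
    using bij X
    by (simp add: tensor_map_comp[OF S M N M f g] tensor_map_id[OF S M] bij_betw_def
        tensor_map_cong[OF S M M mod_hom_comp[OF f g] id(1)])
  moreover have "tensor_map R S M N f (tensor_map R S N M ?g X) = X" if X: "X \<in> carrier (tensor R S N)" for X
    using bij X
    by (simp add: tensor_map_comp[OF S N M N g f] tensor_map_id[OF S N] bij_betw_inv_into_right
        tensor_map_cong[OF S N N mod_hom_comp[OF g f] id(2)])
  moreover note hom_carrier[OF tensor_map_hom[OF S M N f]] hom_carrier[OF tensor_map_hom[OF S N M g]]
  ultimately have "bij_betw (tensor_map R S M N f) (carrier (tensor R S M)) (carrier (tensor R S N))"
    by (intro bij_betw_byWitness[where f' = "tensor_map R S N M ?g"]) blast+
  then show ?thesis
    using tensor_map_hom[OF S M N f] by (simp add: iso_def)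
qed

section \<open>Isomorphism invariance of coneatness\<close>

text \<open>The squares commute and the vertical maps \<open>a\<close>, \<open>b\<close>,
  \<open>k\<close> are bijective, so images and kernels in the new row are the transported ones of
  the old row.\<close>

lemma short_exact_iso:
  assumes ex: "short_exact G H K f g" and K: "group K" "group K'"
    and a: "a \<in> iso G G'" and b: "b \<in> iso H H'" and k: "k \<in> iso K K'"
    and f': "f' \<in> hom G' H'" and g': "g' \<in> hom H' K'"
    and fa: "\<And>x. x \<in> carrier G \<Longrightarrow> f' (a x) = b (f x)"
    and gb: "\<And>x. x \<in> carrier H \<Longrightarrow> g' (b x) = k (g x)"
  shows "short_exact G' H' K' f' g'"
proof -
  have f: "f \<in> hom G H" and g: "g \<in> hom H K" and inj: "inj_on f (carrier G)"
    and ker: "f ` carrier G = kernel H K g" and surj: "g ` carrier H = carrier K"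
    using ex by (auto simp: short_exact_def)
  have G': "carrier G' = a ` carrier G" and H': "carrier H' = b ` carrier H"
    and K': "carrier K' = k ` carrier K" and injs: "inj_on b (carrier H)" "inj_on k (carrier K)"
    using a b k by (auto simp: iso_def bij_betw_def)
  have "k \<in> hom K K'"
    using k by (simp add: iso_def)
  \<comment> \<open>Kernels are fibres over the identity, so comparing them requires that
    \<open>k\<close> preserve it.\<close>
  then have one: "k \<one>\<^bsub>K\<^esub> = \<one>\<^bsub>K'\<^esub>"
    using K by (metis hom_one)
  have "inj_on f' (carrier G')"
    using inj injs(1) f unfolding G' by (fastforce simp: inj_on_def fa hom_in_carrier)
  moreover have "f' ` carrier G' = b ` (f ` carrier G)"
    unfolding G' using fa by force
  moreover have "kernel H' K' g' = b ` kernel H K g"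
  proof -
    have "k (g x) = \<one>\<^bsub>K'\<^esub> \<longleftrightarrow> g x = \<one>\<^bsub>K\<^esub>" if "x \<in> carrier H" for x
      using inj_on_eq_iff[OF injs(2), of "g x" "\<one>\<^bsub>K\<^esub>"] one that g K(1)
      by (auto simp: hom_in_carrier group.is_monoid monoid.one_closed)
    then show ?thesis
      using one by (auto simp: kernel_def H' gb)
  qed
  moreover have "g' ` carrier H' = carrier K'"
    unfolding H' K' surj[symmetric] using gb by force
  ultimately show ?thesis
    using f' g' ker by (simp add: short_exact_def)
qed

text \<open>The map \<open>h\<close> induces isomorphisms of the submodules, the modules and the
  quotients. Tensoring with \<open>S\<close> turns them into an isomorphism between the two
  sequences, along which exactness is carried by \<open>short_exact_iso\<close>. The two modules may
  live on different types.\<close>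

lemma coneat_iso:
  assumes B: "left_module R B" and B': "left_module R B'"
    and h: "h \<in> mod_hom R B B'" and bij: "bij_betw h (carrier B) (carrier B')"
    and con: "coneat R A B"
  shows "coneat R (h ` A) B'"
proof -
  interpret B: left_module R B by fact
  interpret B': left_module R B' by fact
  have A: "submodule A R B"
    using con by (simp add: coneat_def)
  have A': "submodule (h ` A) R B'"
    using B' h A by (rule B.submodule_image)
  have sub: "A \<subseteq> carrier B"
    using A by (rule B.submoduleD)
  let ?A = "B\<lparr>carrier := A\<rparr>" and ?A' = "B'\<lparr>carrier := h ` A\<rparr>"
  let ?Q = "quotient_module R B A" and ?Q' = "quotient_module R B' (h ` A)"
  let ?p = "\<lambda>x. A +>\<^bsub>B\<^esub> x" and ?p' = "\<lambda>x. h ` A +>\<^bsub>B'\<^esub> x"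
  note mods = B.left_module_submodule[OF A] B'.left_module_submodule[OF A']
    B.left_module_quotient[OF A] B'.left_module_quotient[OF A']
  have coset: "h ` ?p x = ?p' (h x)" if "x \<in> carrier B" for x
    using h sub that by (rule B.image_a_r_coset)
  have hA: "h \<in> mod_hom R ?A ?A'"
    using sub by (auto intro!: mod_homI mod_homD[OF h])
  have bijA: "bij_betw h (carrier ?A) (carrier ?A')"
    using bij sub by (auto simp: bij_betw_def intro: inj_on_subset)
  \<comment> \<open>Elements of the quotient are subsets of \<open>B\<close>, so the induced map is
    the direct image.\<close>
  have hQ: "(`) h \<in> mod_hom R ?Q ?Q'"
    using mod_homD[OF h] B.smult_closed
    by (intro mod_homI) (clarsimp simp: B.carrier_quotient_module
        B'.carrier_quotient_module coset B.quotient_add[OF A] B'.quotient_add[OF A']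
        B.quotient_smult[OF A] B'.quotient_smult[OF A'])+
  have bijQ: "bij_betw ((`) h) (carrier ?Q) (carrier ?Q')"
    unfolding bij_betw_def
  proof
    have subQ: "X \<subseteq> carrier B" if "X \<in> carrier ?Q" for X
      using that abelian_subgroup.a_rcosets_carrier[OF B.abelian_subgroup_submodule[OF A]]
      by (simp add: quotient_module_def)
    have "inj_on h (carrier B)"
      using bij by (simp add: bij_betw_def)
    then show "inj_on ((`) h) (carrier ?Q)"
      by (intro inj_onI) (simp add: inj_on_image_eq_iff[of h "carrier B"] subQ)
    have "carrier B' = h ` carrier B"
      using bij by (simp add: bij_betw_def)
    then show "(`) h ` carrier ?Q = carrier ?Q'"
      unfolding B.carrier_quotient_module B'.carrier_quotient_module image_image
      by (simp add: coset image_image cong: image_cong_simp)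
  qed
  have incl: "(\<lambda>x. x) \<in> mod_hom R ?A B" "(\<lambda>x. x) \<in> mod_hom R ?A' B'"
    using sub B'.submoduleD(1)[OF A'] by (auto intro!: mod_homI)
  have proj: "?p \<in> mod_hom R B ?Q" "?p' \<in> mod_hom R B' ?Q'"
    using A A' by (auto intro: B.mod_hom_quotient B'.mod_hom_quotient)
  \<comment> \<open>The type variable \<open>'a\<close> is here the type of the elements of
    \<open>R\<close>, so that \<open>S\<close> ranges over the simple modules of
    \<open>coneat_def\<close>.\<close>
  have "short_exact (tensor R S ?A') (tensor R S B') (tensor R S ?Q')
      (tensor_map R S ?A' B' (\<lambda>x. x)) (tensor_map R S B' ?Q' ?p')"
    if simple: "simple_right_module R S" for S :: "('a, 'a set) module"
  proof -
    have S: "right_module R S"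
      using simple by (simp add: simple_right_module_def)
    have "short_exact (tensor R S ?A) (tensor R S B) (tensor R S ?Q)
        (tensor_map R S ?A B (\<lambda>x. x)) (tensor_map R S B ?Q ?p)"
      using con simple by (simp add: coneat_def)
    then show ?thesis
    proof (rule short_exact_iso)
      show "group (tensor R S ?Q)" "group (tensor R S ?Q')"
        using S mods by (auto intro: group_tensor)
      show "tensor_map R S ?A ?A' h \<in> iso (tensor R S ?A) (tensor R S ?A')"
        using S mods(1,2) hA bijA by (rule tensor_map_iso)
      show "tensor_map R S B B' h \<in> iso (tensor R S B) (tensor R S B')"
        using S B B' h bij by (rule tensor_map_iso)
      show "tensor_map R S ?Q ?Q' ((`) h) \<in> iso (tensor R S ?Q) (tensor R S ?Q')"
        using S mods(3,4) hQ bijQ by (rule tensor_map_iso)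
      show "tensor_map R S ?A' B' (\<lambda>x. x) \<in> hom (tensor R S ?A') (tensor R S B')"
        using S mods(2) B' incl(2) by (rule tensor_map_hom)
      show "tensor_map R S B' ?Q' ?p' \<in> hom (tensor R S B') (tensor R S ?Q')"
        using S B' mods(4) proj(2) by (rule tensor_map_hom)
      show "tensor_map R S ?A' B' (\<lambda>x. x) (tensor_map R S ?A ?A' h X)
          = tensor_map R S B B' h (tensor_map R S ?A B (\<lambda>x. x) X)"
        if X: "X \<in> carrier (tensor R S ?A)" for X
        using tensor_map_comp[OF S mods(1,2) B' hA incl(2) X]
          tensor_map_comp[OF S mods(1) B B' incl(1) h X]
        by (simp add: comp_def)
      show "tensor_map R S B' ?Q' ?p' (tensor_map R S B B' h X)
          = tensor_map R S ?Q ?Q' ((`) h) (tensor_map R S B ?Q ?p X)"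
        if X: "X \<in> carrier (tensor R S B)" for X
        using tensor_map_comp[OF S B B' mods(4) h proj(2) X]
          tensor_map_comp[OF S B mods(3,4) proj(1) hQ X]
          \<comment> \<open>Unlike the square of inclusions, the square of projections commutes only
            on \<open>carrier B\<close>, where \<open>coset\<close> applies.\<close>
          tensor_map_cong[OF S B mods(4) mod_hom_comp[OF h proj(2)] mod_hom_comp[OF proj(1) hQ] _ X]
        by (simp add: coset)
    qed
  qed
  with A' show ?thesis
    by (simp add: coneat_def)
qed

text \<open>Injectivity of \<open>E\<close> speaks of modules on its own type only. The extension
  problem is therefore moved along \<open>r\<close> to a copy \<open>C\<close> of \<open>B\<close>
  on that type, solved there, and the solution is composed with \<open>r\<close>.\<close>

lemma coneat_injective_extend:
  fixes B :: "('r, 'b) module" and r :: "'b \<Rightarrow> 'a" and E :: "('r, 'a) module"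
  assumes E: "coneat_injective R E" and B: "left_module R B" and r: "inj_on r (carrier B)"
    and A: "coneat R A B" and f: "f \<in> mod_hom R (B\<lparr>carrier := A\<rparr>) E"
  obtains g where "g \<in> mod_hom R B E" "\<And>x. x \<in> A \<Longrightarrow> g x = f x"
proof -
  obtain C where C: "left_module R C" and cC: "carrier C = r ` carrier B" and rh: "r \<in> mod_hom R B C"
    using left_module.left_module_copy[OF B r] by blast
  have bij: "bij_betw r (carrier B) (carrier C)"
    using r cC by (simp add: bij_betw_def)
  have con: "coneat R (r ` A) C"
    using B C rh bij A by (rule coneat_iso)
  have subA: "submodule A R B"
    using A by (simp add: coneat_def)
  have sub: "A \<subseteq> carrier B"
    using B subA by (rule left_module.submoduleD)
  let ?A = "B\<lparr>carrier := A\<rparr>" and ?C = "C\<lparr>carrier := r ` A\<rparr>"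
  have "r \<in> mod_hom R ?A ?C"
    using sub by (auto intro!: mod_homI mod_homD[OF rh])
  moreover have bijA: "bij_betw r (carrier ?A) (carrier ?C)"
    using r sub by (auto simp: bij_betw_def intro: inj_on_subset)
  ultimately have "inv_into A r \<in> mod_hom R ?C ?A"
    using mod_hom_inv_into[OF left_module.left_module_submodule[OF B subA]] by fastforce
  \<comment> \<open>This is \<open>f\<close> read on the copy of \<open>A\<close>, the map to be
    extended over \<open>C\<close>.\<close>
  then have "f \<circ> inv_into A r \<in> mod_hom R ?C E"
    using f by (rule mod_hom_comp)
  then have "\<exists>g\<in>mod_hom R C E. \<forall>y\<in>r ` A. g y = (f \<circ> inv_into A r) y"
    using E C con by (simp only: coneat_injective_def)
  then obtain g where g: "g \<in> mod_hom R C E" "\<forall>y\<in>r ` A. g y = (f \<circ> inv_into A r) y"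
    by blast
  show thesis
  proof
    show "g \<circ> r \<in> mod_hom R B E"
      using rh g(1) by (rule mod_hom_comp)
    show "(g \<circ> r) x = f x" if "x \<in> A" for x
      using that g(2) bijA by (simp add: bij_betw_def)
  qed
qed

section \<open>Coneat essentiality of the envelope\<close>

theorem proposition2p11:
  fixes R :: "('r, 'z) ring_scheme" and M E :: "('r, 'a) module"
  assumes "ring R"
    and "left_module R M"
    and "coneat_injective_envelope R M E"
  shows "coneat_essential TYPE('x) R (carrier M) E"
  unfolding coneat_essential_def
proof (intro conjI allI impI)
  have inj_E: "coneat_injective R E" and ME: "contained_module R M E"
    and automorphism: "\<And>h. \<lbrakk>h \<in> mod_hom R E E; \<forall>x\<in>carrier M. h x = x\<rbrakk> \<Longrightarrow> bij_betw h (carrier E) (carrier E)"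
    using assms(3) by (auto simp: coneat_injective_envelope_def)
  show "coneat R (carrier M) E"
    using assms(3) by (simp add: coneat_injective_envelope_def)
  have E: "left_module R E"
    using inj_E by (simp add: coneat_injective_def)
  have subM: "submodule (carrier M) R E"
    using ME by (simp add: contained_module_def)
  have M: "carrier M \<subseteq> carrier E"
    using E subM by (rule left_module.submoduleD)
  fix X :: "('r, 'x) module" and \<phi>
  assume "left_module R X \<and> \<phi> \<in> mod_hom R E X \<and> inj_on \<phi> (carrier M) \<and>
    coneat R (\<phi> ` carrier M) (X\<lparr>carrier := \<phi> ` carrier E\<rparr>)"
  then have X: "left_module R X" and \<phi>: "\<phi> \<in> mod_hom R E X" and inj: "inj_on \<phi> (carrier M)"
    and con: "coneat R (\<phi> ` carrier M) (X\<lparr>carrier := \<phi> ` carrier E\<rparr>)"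
    by auto
  \<comment> \<open>\<open>E\<close> cut down to the carrier of \<open>M\<close> stands in for
    \<open>M\<close>, whose operations are only known to agree with those of \<open>E\<close> on
    that carrier.\<close>
  let ?I = "X\<lparr>carrier := \<phi> ` carrier E\<rparr>" and ?M = "E\<lparr>carrier := carrier M\<rparr>"
  let ?A = "?I\<lparr>carrier := \<phi> ` carrier M\<rparr>" and ?f = "inv_into (carrier M) \<phi>"
  have I: "left_module R ?I"
    using left_module.submodule_image[OF E X \<phi> left_module.carrier_submodule[OF E]]
    by (rule left_module.left_module_submodule[OF X])
  have \<phi>I: "\<phi> \<in> mod_hom R E ?I"
    by (rule mod_homI) (auto simp: mod_homD[OF \<phi>])
  have "\<phi> \<in> mod_hom R ?M ?A"
    using M by (auto intro!: mod_homI mod_homD[OF \<phi>])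
  moreover have "bij_betw \<phi> (carrier ?M) (carrier ?A)"
    using inj by (simp add: bij_betw_def)
  ultimately have "?f \<in> mod_hom R ?A ?M"
    using mod_hom_inv_into[OF left_module.left_module_submodule[OF E subM]] by fastforce
  \<comment> \<open>The target is enlarged from the submodule to \<open>E\<close>, where injectivity
    is available.\<close>
  then have f: "?f \<in> mod_hom R ?A E"
    using M by (auto simp: mod_hom_def hom_def)
  \<comment> \<open>Choosing a preimage in \<open>E\<close> for each element of the image of \<phi>
    embeds that image, merely as a set, into the type of \<open>E\<close>; this is the injection for
    \<open>coneat_injective_extend\<close>.\<close>
  have "inj_on (inv_into (carrier E) \<phi>) (carrier ?I)"
    by (simp add: inj_on_inv_into)
  then obtain g where g: "g \<in> mod_hom R ?I E" and gf: "\<And>y. y \<in> \<phi> ` carrier M \<Longrightarrow> g y = ?f y"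
    using coneat_injective_extend[OF inj_E I _ con f] by blast
  \<comment> \<open>On \<open>M\<close> the map \<open>g\<close> undoes \<phi>, so the composite
    fixes \<open>M\<close> pointwise and the envelope property applies.\<close>
  have "bij_betw (g \<circ> \<phi>) (carrier E) (carrier E)"
    using inj by (intro automorphism mod_hom_comp[OF \<phi>I g]) (simp add: gf)
  then show "inj_on \<phi> (carrier E)"
    by (auto simp: bij_betw_def intro: inj_on_imageI2)
qed

end
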